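(* Let $G$ be a graph with vertex set $V(G)=\{x_1,\ldots,x_n\}$ and complement $\overline{G}$, let $S=K[x_1,\ldots,x_n]$ be a polynomial ring over a field $K$, and let $d=\beta_0(G)=\dim(S/I(G))$ be the independence number of $G$. The following hold. (a) If $A_1,\ldots,A_d$ are cliques of $G$ that form a partition of $V(G)$, then the polynomials $f_i=\sum_{x_j\in A_i}x_j$, $i=1,\ldots,d$, form a 0-1 linear system of parameters of $S/I(G)$. (b) If $G$ is a perfect graph, then $S/I(G)$ has a 0-1 linear system of parameters coming from a partition of $V(\overline{G})$ into $\chi(\overline{G})$ color classes of $\overline{G}$; that is, there is a partition $A_1,\ldots,A_m$ of $V(\overline G)$, $m=\chi(\overline{G})$, into independent sets of $\overline{G}$ such that the polynomials $f_i=\sum_{x_j\in A_i}x_j$, $i=1,\ldots,m$, form a 0-1 linear system of parameters of $S/I(G)$.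
   Context: Graphs are finite and simple; vertices are identified with the variables of $S$. The edge ideal of $G$ is $I(G)=(x_ix_j \mid \{x_i,x_j\}\in E(G))\subset S$. The independence number $\beta_0(G)$ is the largest size of an independent set of vertices; it equals $\dim(S/I(G))$. A clique of $G$ is a subset $A\subset V(G)$ such that the induced subgraph $G[A]$ is complete; $\omega(G)$ is the size of a largest clique; $\chi(G)$ is the chromatic number (the minimum number of independent sets in a partition of $V(G)$). $G$ is perfect if $\omega(H)=\chi(H)$ for every induced subgraph $H$ of $G$. With $\mathfrak m=(x_1,\ldots,x_n)$, linear forms $f_1,\ldots,f_d\in S$ form a linear system of parameters for $S/I(G)$ if $d=\dim(S/I(G))$ and $\mathrm{rad}(I(G),f_1,\ldots,f_d)=\mathfrak m$; it is a 0-1 linear system of parameters if all coefficients of the $f_i$ lie in $\{0,1\}\subset K$. *)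

theory Defs
  imports
    "HOL-Library.Poly_Mapping"
    "HOL-Library.Ramsey"
    "HOL-Library.Disjoint_Sets"
    "HOL-Library.Extended_Nat"
    "HOL-Algebra.Algebra"
    "HOL-Algebra.Algebraic_Closure_Type"
begin

section \<open>Graphs\<close>

text \<open>
  A graph is given by a vertex set \<open>V\<close> and a set \<open>E\<close> of two-element subsets of \<open>V\<close>.
  Cliques and independent sets are \<^const>\<open>clique\<close> and \<^const>\<open>indep\<close> from
  \<^theory>\<open>HOL-Library.Ramsey\<close>; they do not mention \<open>V\<close>, so inclusion in \<open>V\<close> is always
  demanded separately.
\<close>

definition simple_graph :: "'v set \<Rightarrow> 'v set set \<Rightarrow> bool" where
  "simple_graph V E \<longleftrightarrow> finite V \<and> E \<subseteq> nsets V 2"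

definition complement_edges :: "'v set \<Rightarrow> 'v set set \<Rightarrow> 'v set set" where
  "complement_edges V E = nsets V 2 - E"

definition induced_edges :: "'v set set \<Rightarrow> 'v set \<Rightarrow> 'v set set" where
  "induced_edges E W = {e \<in> E. e \<subseteq> W}"

definition independence_number :: "'v set \<Rightarrow> 'v set set \<Rightarrow> nat" where
  "independence_number V E = Max (card ` {A. A \<subseteq> V \<and> indep A E})"

definition clique_number :: "'v set \<Rightarrow> 'v set set \<Rightarrow> nat" where
  "clique_number V E = Max (card ` {A. A \<subseteq> V \<and> clique A E})"

definition chromatic_number :: "'v set \<Rightarrow> 'v set set \<Rightarrow> nat" where
  "chromatic_number V E =
     (LEAST k. \<exists>P. partition_on V P \<and> card P = k \<and> (\<forall>A\<in>P. indep A E))"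

definition perfect_graph :: "'v set \<Rightarrow> 'v set set \<Rightarrow> bool" where
  "perfect_graph V E \<longleftrightarrow>
     (\<forall>W\<subseteq>V. clique_number W (induced_edges E W) = chromatic_number W (induced_edges E W))"

text \<open>A partition \<open>A\<^sub>1, \<dots>, A\<^sub>m\<close> into \<open>m\<close> blocks, given as the list of its blocks.\<close>

definition partition_list :: "'v set \<Rightarrow> 'v set list \<Rightarrow> bool" where
  "partition_list V As \<longleftrightarrow> distinct As \<and> partition_on V (set As)"

section \<open>Ring theory\<close>

definition radical_ideal :: "('a, 'b) ring_scheme \<Rightarrow> 'a set \<Rightarrow> 'a set" where
  "radical_ideal R I = {x \<in> carrier R. \<exists>n::nat. n > 0 \<and> x [^]\<^bsub>R\<^esub> n \<in> I}"

text \<open>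
  The Krull dimension is the supremum of the lengths \<open>n\<close> of strictly increasing chains
  \<open>P\<^sub>0 \<subset> \<dots> \<subset> P\<^sub>n\<close> of prime ideals. The zero ring has no prime ideals and gets the
  value \<open>0\<close>.
\<close>

definition krull_dim :: "('a, 'b) ring_scheme \<Rightarrow> enat" where
  "krull_dim R = Sup {enat n | n. \<exists>P :: nat \<Rightarrow> 'a set.
     (\<forall>i\<le>n. primeideal (P i) R) \<and> (\<forall>i<n. P i \<subset> P (Suc i))}"

section \<open>The polynomial ring on the vertices and the edge ideal\<close>

text \<open>
  \<open>('v, 'k) mpoly\<close> is the monoid algebra over \<open>'k\<close> of the monomials (finitely supported
  exponent functions) in the variables \<open>'v\<close>, i.e. the polynomial ring with one variable for
  each element of \<open>'v\<close>.
\<close>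

type_synonym ('v, 'k) mpoly = "('v \<Rightarrow>\<^sub>0 nat) \<Rightarrow>\<^sub>0 'k"

definition Var :: "'v \<Rightarrow> ('v, 'k::field) mpoly" where
  "Var v = Poly_Mapping.single (Poly_Mapping.single v 1) 1"

abbreviation poly_ring :: "('v, 'k::field) mpoly ring" where
  "poly_ring \<equiv> ring_of_type_algebra"

definition edge_ideal :: "'v set set \<Rightarrow> ('v, 'k::field) mpoly set" where
  "edge_ideal E = genideal poly_ring {Var u * Var v | u v. {u, v} \<in> E}"

definition irrelevant_ideal :: "('v, 'k::field) mpoly set" where
  "irrelevant_ideal = genideal poly_ring (range Var)"

text \<open>Homogeneous of degree one; the zero polynomial is allowed.\<close>

definition linear_form :: "('v, 'k::field) mpoly \<Rightarrow> bool" where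
  "linear_form f \<longleftrightarrow> (\<forall>m \<in> Poly_Mapping.keys f. \<exists>v. m = Poly_Mapping.single v 1)"

definition linear_sop :: "('v, 'k::field) mpoly set \<Rightarrow> ('v, 'k) mpoly list \<Rightarrow> bool" where
  "linear_sop I fs \<longleftrightarrow>
     (\<forall>f \<in> set fs. linear_form f) \<and>
     enat (length fs) = krull_dim (poly_ring Quot I) \<and>
     radical_ideal poly_ring (genideal poly_ring (I \<union> set fs)) = irrelevant_ideal"

definition zero_one_linear_sop ::
    "('v, 'k::field) mpoly set \<Rightarrow> ('v, 'k) mpoly list \<Rightarrow> bool" where
  "zero_one_linear_sop I fs \<longleftrightarrow>
     linear_sop I fs \<and> (\<forall>f \<in> set fs. \<forall>m. Poly_Mapping.lookup f m \<in> {0, 1})"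

end

theory Submission
  imports Defs
begin

text \<open>
  If \<open>x\<^sub>j\<close> lies in the clique \<open>A\<^sub>i\<close>, then \<open>x\<^sub>j f\<^sub>i\<close> and \<open>x\<^sub>j\<^sup>2\<close> agree modulo the
  edge ideal, so every variable lies in the radical. That the dimension is the independence number is
  seen on chains of primes: ideals generated by variables give a long chain, and the complement of the
  variables in the smallest prime of any chain is independent. If a chain had more steps than this
  set has elements, then elements separating consecutive primes would satisfy a polynomial relation,
  because there are fewer monomials of bounded degree in the variables than products of bounded degree
  of the elements; the lexicographically smallest term of the relation gives a contradiction.

  For perfect graphs, the complement has as many colour classes as the largest independent set has
  elements by the weak perfect graph theorem, which is proved by Gasparian's rank argument.
\<close>

section \<open>Linear relations\<close>

text \<open>Gaussian elimination, one row at a time. It serves twice: over the rationals for the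
  incidence matrix of cliques and independent sets, and over the ground field for comparing
  monomials with products of polynomials.\<close>

lemma nontrivial_linear_relation:
  fixes M :: "'x \<Rightarrow> 'j \<Rightarrow> 'k::field"
  assumes "finite Z" "finite J" "card Z < card J"
  shows "\<exists>c. (\<exists>j\<in>J. c j \<noteq> 0) \<and> (\<forall>x\<in>Z. (\<Sum>j\<in>J. c j * M x j) = 0)"
  using assms
proof (induction Z arbitrary: J M rule: finite_induct)
  case empty
  then obtain j where "j \<in> J" by fastforce
  then show ?case by (intro exI[of _ "\<lambda>_. 1"]) auto
next
  case (insert x Z)
  show ?case
  proof (cases "\<forall>j\<in>J. M x j = 0")
    case True
    obtain c where "\<exists>j\<in>J. c j \<noteq> 0" "\<forall>y\<in>Z. (\<Sum>j\<in>J. c j * M y j) = 0"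
      using insert.IH[of J M] insert.prems insert.hyps by auto
    with True show ?thesis by (intro exI[of _ c]) auto
  next
    case False
    then obtain p where p: "p \<in> J" "M x p \<noteq> 0" by blast
    \<comment> \<open>The multiple of row \<open>x\<close> subtracted from row \<open>y\<close>
      clears column \<open>p\<close>, which can then be dropped.\<close>
    define M' where "M' y j = M y j - M x j / M x p * M y p" for y j
    have "card Z < card (J - {p})"
      using insert.prems insert.hyps p by simp
    then obtain c where c: "\<exists>j\<in>J - {p}. c j \<noteq> 0" "\<forall>y\<in>Z. (\<Sum>j\<in>J - {p}. c j * M' y j) = 0"
      using insert.IH[of "J - {p}" M'] insert.prems by auto
    \<comment> \<open>The equation of row \<open>x\<close> determines \<open>t\<close> once column
      \<open>p\<close> gets the coefficient \<open>- t\<close>.\<close>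
    define t where "t = (\<Sum>j\<in>J - {p}. c j * M x j) / M x p"
    define c' where "c' = c(p := - t)"
    have split: "(\<Sum>j\<in>J. c' j * M y j) = (\<Sum>j\<in>J - {p}. c j * M y j) - t * M y p" for y
    proof -
      have "(\<Sum>j\<in>J - {p}. c' j * M y j) = (\<Sum>j\<in>J - {p}. c j * M y j)"
        by (intro sum.cong) (auto simp: c'_def)
      then show ?thesis
        using p insert.prems by (simp add: sum.remove[of J p] c'_def)
    qed
    have "(\<Sum>j\<in>J. c' j * M y j) = 0" if "y \<in> Z" for y
    proof -
      have "(\<Sum>j\<in>J - {p}. c j * M' y j) = (\<Sum>j\<in>J - {p}. c j * M y j) - t * M y p"
        unfolding M'_def t_def
        by (simp add: algebra_simps sum_subtractf sum_distrib_left sum_divide_distrib)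
      then show ?thesis using c(2) that split by simp
    qed
    moreover have "(\<Sum>j\<in>J. c' j * M x j) = 0"
      unfolding split using p by (simp add: t_def)
    moreover have "\<exists>j\<in>J. c' j \<noteq> 0" using c(1) by (auto simp: c'_def)
    ultimately show ?thesis by (intro exI[of _ c']) auto
  qed
qed

section \<open>Perfect graphs\<close>

lemma card_le_clique_number:
  assumes "finite W" "A \<subseteq> W" "clique A E"
  shows "card A \<le> clique_number W E"
  unfolding clique_number_def using assms by (intro Max_ge) auto

lemma card_le_independence_number:
  assumes "finite W" "A \<subseteq> W" "indep A E"
  shows "card A \<le> independence_number W E"
  unfolding independence_number_def using assms by (intro Max_ge) auto

lemma ex_clique_number:
  assumes "finite W"
  obtains A where "A \<subseteq> W" "clique A E" "card A = clique_number W E"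
proof -
  have "clique_number W E \<in> card ` {A. A \<subseteq> W \<and> clique A E}"
    unfolding clique_number_def using assms by (intro Max_in) (auto intro: null_clique)
  then show thesis using that by force
qed

lemma ex_independence_number:
  assumes "finite W"
  obtains A where "A \<subseteq> W" "indep A E" "card A = independence_number W E"
proof -
  have "independence_number W E \<in> card ` {A. A \<subseteq> W \<and> indep A E}"
    unfolding independence_number_def using assms by (intro Max_in) (auto intro: null_indep)
  then show thesis using that by force
qed

text \<open>Two common vertices would be adjacent and nonadjacent at once.\<close>

lemma card_clique_Int_indep:
  assumes "clique Q E" "indep A E"
  shows "card (Q \<inter> A) \<le> 1"
proof -
  have "u = v" if "u \<in> Q \<inter> A" "v \<in> Q \<inter> A" for u v
    using assms that by (auto simp: clique_def indep_def)
  then show ?thesis by (metis One_nat_def card_le_Suc0_iff_eq card.infinite le0)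
qed

lemma clique_induced_edges: "A \<subseteq> W \<Longrightarrow> clique A (induced_edges E W) = clique A E"
  by (auto simp: clique_def induced_edges_def subset_iff)

lemma indep_induced_edges: "A \<subseteq> W \<Longrightarrow> indep A (induced_edges E W) = indep A E"
  by (auto simp: indep_def induced_edges_def subset_iff)

lemma clique_complement_edges: "A \<subseteq> V \<Longrightarrow> clique A (complement_edges V E) = indep A E"
  by (auto simp: clique_def indep_def complement_edges_def nsets_def subset_iff)

lemma indep_complement_edges: "A \<subseteq> V \<Longrightarrow> indep A (complement_edges V E) = clique A E"
  by (auto simp: clique_def indep_def complement_edges_def nsets_def subset_iff)

section \<open>Proper colourings and partitions into independent sets\<close>

definition proper_coloring :: "'v set set \<Rightarrow> 'v set \<Rightarrow> nat \<Rightarrow> ('v \<Rightarrow> nat) \<Rightarrow> bool" where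
  "proper_coloring E W k f \<longleftrightarrow>
     f ` W \<subseteq> {..<k} \<and> (\<forall>u\<in>W. \<forall>v\<in>W. u \<noteq> v \<and> {u, v} \<in> E \<longrightarrow> f u \<noteq> f v)"

lemma proper_coloring_mono: "proper_coloring E W k f \<Longrightarrow> k \<le> l \<Longrightarrow> proper_coloring E W l f"
  by (force simp: proper_coloring_def)

lemma proper_coloring_inj_on:
  "proper_coloring E W k f \<Longrightarrow> Q \<subseteq> W \<Longrightarrow> clique Q E \<Longrightarrow> inj_on f Q"
  unfolding proper_coloring_def clique_def inj_on_def by blast

lemma indep_color_class:
  "proper_coloring E W k f \<Longrightarrow> indep {u \<in> W. f u = c} E"
  unfolding proper_coloring_def indep_def by (auto 4 4)

lemma proper_coloring_add_class:
  assumes g: "proper_coloring E (W - B) k g" and B: "indep B E"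
  shows "\<exists>f. proper_coloring E W (Suc k) f"
proof -
  let ?f = "\<lambda>u. if u \<in> B then k else g u"
  have lt: "g u < k" if "u \<in> W - B" for u using g that by (auto simp: proper_coloring_def)
  have "?f u \<noteq> ?f v" if "u \<in> W" "v \<in> W" "u \<noteq> v" "{u, v} \<in> E" for u v
  proof -
    have "\<not> (u \<in> B \<and> v \<in> B)" using B that by (auto simp: indep_def)
    moreover have "g u \<noteq> g v" if "u \<notin> B" "v \<notin> B"
      using g \<open>u \<in> W\<close> \<open>v \<in> W\<close> \<open>u \<noteq> v\<close> \<open>{u, v} \<in> E\<close> that unfolding proper_coloring_def by blast
    ultimately show ?thesis using lt[of u] lt[of v] that by auto
  qed
  moreover have "?f ` W \<subseteq> {..<Suc k}" using lt by (auto simp: less_Suc_eq)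
  ultimately show ?thesis unfolding proper_coloring_def by (intro exI[of _ ?f]) blast
qed

lemma proper_coloring_partition:
  assumes "proper_coloring E W k f"
  shows "\<exists>P. partition_on W P \<and> card P \<le> k \<and> (\<forall>A\<in>P. indep A E)"
proof (intro exI conjI ballI)
  let ?P = "(\<lambda>c. {u \<in> W. f u = c}) ` (f ` W)"
  have sub: "f ` W \<subseteq> {..<k}" using assms by (auto simp: proper_coloring_def)
  show "partition_on W ?P"
    by (rule partition_onI) (auto simp: disjnt_def)
  have "card ?P \<le> card (f ` W)"
    using finite_subset[OF sub] by (intro card_image_le) auto
  also have "\<dots> \<le> k" using card_mono[OF _ sub] by simp
  finally show "card ?P \<le> k" .
  show "indep A E" if "A \<in> ?P" for A
    using that indep_color_class[OF assms] by auto
qed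

lemma ex_chromatic_number:
  obtains P where "partition_on V P" "card P = chromatic_number V E" "\<forall>A\<in>P. indep A E"
proof -
  have "partition_on V ((\<lambda>v. {v}) ` V)"
    by (rule partition_onI) (auto simp: disjnt_def)
  then have "\<exists>k P. partition_on V P \<and> card P = k \<and> (\<forall>A\<in>P. indep A E)"
    by (intro exI[of _ "card ((\<lambda>v. {v}) ` V)"] exI[of _ "(\<lambda>v. {v}) ` V"]) (auto simp: indep_def)
  from LeastI_ex[OF this] show thesis
    using that unfolding chromatic_number_def by blast
qed

lemma chromatic_number_le:
  "partition_on V P \<Longrightarrow> \<forall>A\<in>P. indep A E \<Longrightarrow> chromatic_number V E \<le> card P"
  unfolding chromatic_number_def by (rule Least_le) auto

text \<open>A clique meets each independent block in at most one vertex.\<close>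

lemma card_clique_le_partition:
  assumes "finite V" "partition_on V P" "\<forall>A\<in>P. indep A E" "Q \<subseteq> V" "clique Q E"
  shows "card Q \<le> card P"
proof -
  have fin: "finite P" using assms finite_elements by blast
  have "Q = (\<Union>A\<in>P. Q \<inter> A)" using assms by (auto simp: partition_on_def)
  then have "card Q \<le> (\<Sum>A\<in>P. card (Q \<inter> A))"
    using card_UN_le[OF fin, of "\<lambda>A. Q \<inter> A"] by simp
  also have "\<dots> \<le> card P * 1"
    using sum_bounded_above[of P "\<lambda>A. card (Q \<inter> A)" 1] card_clique_Int_indep[OF assms(5)] assms(3)
    by simp
  finally show ?thesis by simp
qed

text \<open>Perfection splits \<open>W\<close> into as many independent classes as its clique
  number, and none is larger than the independence number.\<close>

lemma perfect_graph_card_le: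
  assumes "finite V" "perfect_graph V E" "W \<subseteq> V"
  shows "card W \<le> independence_number W E * clique_number W E"
proof -
  have finW: "finite W" using assms finite_subset by blast
  obtain P where P: "partition_on W P" "card P = chromatic_number W (induced_edges E W)"
    "\<forall>A\<in>P. indep A (induced_edges E W)" by (rule ex_chromatic_number)
  have sub: "A \<subseteq> W" if "A \<in> P" for A using P that by (auto simp: partition_on_def)
  have "clique_number W (induced_edges E W) = clique_number W E"
    unfolding clique_number_def
    by (intro arg_cong[where f = "\<lambda>S. Max (card ` S)"]) (auto simp: clique_induced_edges)
  then have cP: "card P = clique_number W E"
    using P(2) assms(2,3) by (simp add: perfect_graph_def)
  have "card W = (\<Sum>A\<in>P. card A)"
    using P(1) finW sub finite_subset
    by (metis card_Union_disjoint partition_on_def)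
  also have "\<dots> \<le> card P * independence_number W E"
    using sum_bounded_above[of P card "independence_number W E"] sub P(3) finW
    by (simp add: card_le_independence_number indep_induced_edges)
  finally show ?thesis by (simp add: cP mult.commute)
qed

text \<open>In a smallest counterexample \<open>W\<close>, a largest independent set \<open>A0\<close> and the colour classes of
  all \<open>W - {v}\<close>, \<open>v \<in> A0\<close>, form a family of \<open>\<alpha>\<omega> + 1\<close> independent sets \<open>B j\<close> such that every
  maximum clique misses at most one of them and every \<open>B j\<close> is missed by some maximum clique \<open>Q j\<close>.
  The incidence matrix of the \<open>Q i\<close> and \<open>B j\<close> is thus the all-ones matrix minus the identity,
  which is regular, so that \<open>W\<close> has more than \<open>\<alpha>\<omega>\<close> elements.\<close>

theorem proper_coloring_of_card_le:
  assumes "finite V"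
    and bound: "\<And>W. W \<subseteq> V \<Longrightarrow> card W \<le> independence_number W E * clique_number W E"
    and "W \<subseteq> V"
  shows "\<exists>f. proper_coloring E W (clique_number W E) f"
  using \<open>W \<subseteq> V\<close>
proof (induction "card W" arbitrary: W rule: less_induct)
  case less
  define a w where "a = independence_number W E" and "w = clique_number W E"
  have finW: "finite W" using less.prems assms(1) finite_subset by blast
  show ?case
  proof (cases "W = {}")
    case True
    then show ?thesis by (auto simp: proper_coloring_def)
  next
    case False
    then obtain x where x: "x \<in> W" by blast
    have w_pos: "0 < w" and a_pos: "0 < a"
      using card_le_clique_number[of W "{x}" E] card_le_independence_number[of W "{x}" E] finW x
      by (auto simp: w_def a_def clique_def indep_def)
    have clique_le: "card Q \<le> w" if "Q \<subseteq> W" "clique Q E" for Q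
      using card_le_clique_number[OF finW that] by (simp add: w_def)
    have IH: "\<exists>f. proper_coloring E U (clique_number U E) f" if "U \<subset> W" for U
      using less.hyps[of U] less.prems that finW by (auto intro: psubset_card_mono)
    have le_w: "clique_number U E \<le> w" if "U \<subseteq> W" for U
      using ex_clique_number[of U E] clique_le that finW
      by (metis finite_subset subset_trans)
    obtain A0 where A0: "A0 \<subseteq> W" "indep A0 E" "card A0 = a"
      using ex_independence_number[OF finW, of E] by (auto simp: a_def)
    have finA0: "finite A0" using A0 finW finite_subset by blast
    have "\<exists>f. proper_coloring E (W - {v}) w f" if "v \<in> A0" for v
      using IH[of "W - {v}"] le_w[of "W - {v}"] that A0(1) by (blast intro: proper_coloring_mono)
    then obtain F where F: "\<And>v. v \<in> A0 \<Longrightarrow> proper_coloring E (W - {v}) w (F v)" by metis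
    \<comment> \<open>\<open>None\<close> stands for \<open>A0\<close> and
      \<open>Some (v, c)\<close> for colour class \<open>c\<close> of \<open>W - {v}\<close>.
      Classes may be empty or coincide, so indices are counted instead of sets.\<close>
    define J where "J = insert None (Some ` (A0 \<times> {..<w}))"
    define B where
      "B j = (case j of None \<Rightarrow> A0 | Some (v, c) \<Rightarrow> {u \<in> W - {v}. F v u = c})" for j
    have finJ: "finite J" using finA0 by (simp add: J_def)
    have cardJ: "card J = Suc (a * w)"
      using finA0 A0(3)
      by (simp add: J_def card_insert_if card_image inj_on_def card_cartesian_product image_iff)
    have B_sub: "B j \<subseteq> W" for j
      using A0(1) by (auto simp: B_def split: option.splits prod.splits)
    have B_indep: "indep (B j) E" if "j \<in> J" for j
    proof (cases j)
      case None
      then show ?thesis using A0(2) by (simp add: B_def)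
    next
      case (Some p)
      obtain v c where p: "p = (v, c)" by (cases p)
      then have "v \<in> A0" using that Some by (auto simp: J_def)
      from indep_color_class[OF F[OF this], of c] show ?thesis by (simp add: B_def Some p)
    qed
    \<comment> \<open>If \<open>v\<close> were not in \<open>Q\<close>, the \<open>w\<close>
      vertices of \<open>Q\<close> would carry all \<open>w\<close> colours of
      \<open>W - {v}\<close>, including \<open>c\<close>.\<close>
    have mem: "v \<in> Q"
      if "Q \<subseteq> W" "clique Q E" "card Q = w" "Q \<inter> B (Some (v, c)) = {}" "v \<in> A0"
        and c: "c < w" for Q v c
    proof (rule ccontr)
      assume "v \<notin> Q"
      then have sub: "Q \<subseteq> W - {v}" using that(1) by blast
      have "card (F v ` Q) = w"
        using proper_coloring_inj_on[OF F[OF that(5)] sub that(2)] that(3) by (simp add: card_image)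
      moreover have "F v ` Q \<subseteq> {..<w}" using F[OF that(5)] sub by (auto simp: proper_coloring_def)
      ultimately have "F v ` Q = {..<w}" by (intro card_subset_eq) auto
      then obtain u where "u \<in> Q" "F v u = c" using c by (metis imageE lessThan_iff)
      then show False using that(4) sub by (auto simp: B_def)
    qed
    \<comment> \<open>When exactly one of the sets is \<open>A0\<close>, the vertex given by
      \<open>mem\<close> lies in both \<open>Q\<close> and \<open>A0\<close>. When neither is,
      \<open>v\<close> and \<open>v'\<close> lie in \<open>Q\<close> and in \<open>A0\<close>, hence
      agree, and two distinct missed colours would leave too few for the \<open>w - 1\<close>
      vertices of \<open>Q - {v}\<close>.\<close>
    have same: "i = j"
      if Q: "Q \<subseteq> W" "clique Q E" "card Q = w" and iJ: "i \<in> J" "j \<in> J"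
        and disj: "Q \<inter> B i = {}" "Q \<inter> B j = {}" for Q i j
    proof (cases "i = None \<or> j = None")
      case True
      show ?thesis
      proof (rule ccontr)
        assume "i \<noteq> j"
        then obtain v c where "Q \<inter> B (Some (v, c)) = {}" "v \<in> A0" "c < w" "Q \<inter> A0 = {}"
          using True iJ disj by (auto simp: J_def B_def[of None])
        with mem[OF Q] show False by blast
      qed
    next
      case False
      then obtain v c v' c' where ij: "i = Some (v, c)" "j = Some (v', c')"
        and vc: "v \<in> A0" "c < w" "v' \<in> A0" "c' < w"
        using iJ by (auto simp: J_def)
      have "v \<in> Q" "v' \<in> Q" using mem[OF Q] disj ij vc by blast+
      then have vv: "v' = v"
        using Q(2) A0(2) vc by (auto simp: clique_def indep_def)
      have sub: "Q - {v} \<subseteq> W - {v}" using Q(1) by blast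
      have "clique (Q - {v}) E" using Q(2) smaller_clique by blast
      then have "card (F v ` (Q - {v})) = w - 1"
        using proper_coloring_inj_on[OF F[OF vc(1)] sub] Q(3) \<open>v \<in> Q\<close> by (simp add: card_image)
      moreover have "F v ` (Q - {v}) \<subseteq> {..<w} - {c, c'}"
      proof -
        have "F v ` (Q - {v}) \<subseteq> {..<w}"
          using F[OF vc(1)] sub unfolding proper_coloring_def by blast
        moreover have "c \<notin> F v ` (Q - {v})" "c' \<notin> F v ` (Q - {v})"
          using disj Q(1) by (auto simp: B_def ij vv)
        ultimately show ?thesis by blast
      qed
      ultimately have "w - 1 \<le> card ({..<w} - {c, c'})"
        by (metis card_mono finite_Diff finite_lessThan)
      also have "\<dots> = w - card {c, c'}" using vc by (subst card_Diff_subset) auto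
      finally have "c = c'" using vc by (cases "c = c'") auto
      then show ?thesis by (simp add: ij vv)
    qed
    show ?thesis
    proof (rule ccontr)
      assume neg: "\<not> ?thesis"
      \<comment> \<open>If \<open>B j\<close> met every maximum clique, induction would colour
        \<open>W - B j\<close> with \<open>w - 1\<close> colours, and \<open>B j\<close> as one more
        class would colour \<open>W\<close> with \<open>w\<close>. An empty \<open>B j\<close> is
        treated apart because \<open>W - B j\<close> is then not smaller than
        \<open>W\<close>.\<close>
      have "\<exists>Q. Q \<subseteq> W \<and> clique Q E \<and> card Q = w \<and> Q \<inter> B j = {}" if "j \<in> J" for j
      proof (cases "B j = {}")
        case True
        obtain Q where "Q \<subseteq> W" "clique Q E" "card Q = w"
          by (rule ex_clique_number[OF finW, of E, folded w_def])
        with True show ?thesis by (intro exI[of _ Q]) simp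
      next
        case False
        then have psub: "W - B j \<subset> W" using B_sub by blast
        obtain g where g: "proper_coloring E (W - B j) (clique_number (W - B j) E) g"
          using IH[OF psub] by blast
        have "w \<le> clique_number (W - B j) E"
        proof (rule ccontr)
          assume "\<not> w \<le> clique_number (W - B j) E"
          then have "proper_coloring E (W - B j) (w - 1) g"
            using g by (intro proper_coloring_mono[OF g]) simp
          from proper_coloring_add_class[OF this B_indep[OF that]]
          show False using neg w_pos by (simp add: w_def)
        qed
        moreover obtain Q where "Q \<subseteq> W - B j" "clique Q E" "card Q = clique_number (W - B j) E"
          by (rule ex_clique_number[of "W - B j" E]) (use finW in auto)
        ultimately show ?thesis using le_w[of "W - B j"] by (intro exI[of _ Q]) auto
      qed
      then obtain Q where Q: "\<And>j. j \<in> J \<Longrightarrow> Q j \<subseteq> W" "\<And>j. j \<in> J \<Longrightarrow> clique (Q j) E"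
        "\<And>j. j \<in> J \<Longrightarrow> card (Q j) = w" "\<And>j. j \<in> J \<Longrightarrow> Q j \<inter> B j = {}" by metis
      have finQ: "finite (Q j)" if "j \<in> J" for j using Q(1)[OF that] finW finite_subset by blast
      have inter: "card (Q i \<inter> B j) = (if i = j then 0 else 1)" if "i \<in> J" "j \<in> J" for i j
      proof (cases "i = j")
        case True
        then show ?thesis using Q(4) that by simp
      next
        case False
        then have "Q i \<inter> B j \<noteq> {}" using same[of "Q i" i j] Q that by blast
        then have "card (Q i \<inter> B j) \<noteq> 0" using finQ[OF that(1)] by simp
        then show ?thesis
          using False card_clique_Int_indep[OF Q(2)[OF that(1)] B_indep[OF that(2)]] by simp
      qed
      \<comment> \<open>There are fewer vertices than indices, so the indicator vectors of the
        \<open>B j\<close> are linearly dependent.\<close>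
      have "card W < card J" using bound[OF less.prems] cardJ by (simp add: a_def w_def)
      then obtain c :: "_ \<Rightarrow> rat" where c: "\<exists>j\<in>J. c j \<noteq> 0"
        "\<forall>u\<in>W. (\<Sum>j\<in>J. c j * of_bool (u \<in> B j)) = 0"
        using nontrivial_linear_relation[OF finW finJ, of "\<lambda>u j. of_bool (u \<in> B j)"] by blast
      define S where "S = (\<Sum>j\<in>J. c j)"
      \<comment> \<open>Summed over the vertices of \<open>Q i\<close>, the relation counts each
        \<open>c j\<close> with \<open>j\<close> other than \<open>i\<close> exactly once and omits
        \<open>c i\<close>.\<close>
      have c_eq: "c i = S" if "i \<in> J" for i
      proof -
        have "0 = (\<Sum>u\<in>Q i. \<Sum>j\<in>J. c j * of_bool (u \<in> B j))"
          using c(2) Q(1)[OF that] by (intro sum.neutral[symmetric]) auto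
        also have "\<dots> = (\<Sum>j\<in>J. c j * of_nat (card (Q i \<inter> B j)))"
          using finQ[OF that]
          by (subst sum.swap) (simp add: sum_distrib_left[symmetric] Int_def)
        also have "\<dots> = (\<Sum>j\<in>J. c j * (if i = j then 0 else 1))"
          using inter[OF that] by (intro sum.cong) auto
        also have "\<dots> = (\<Sum>j\<in>J - {i}. c j)"
          using finJ that by (intro sum.mono_neutral_cong_right) auto
        also have "\<dots> = S - c i" using finJ that by (simp add: S_def sum_diff1)
        finally show ?thesis by simp
      qed
      \<comment> \<open>\<open>S\<close> equals \<open>a * w + 1\<close> times itself, which forces
        \<open>S = 0\<close> in characteristic zero.\<close>
      have "sum c J = (\<Sum>j\<in>J. S)" by (rule sum.cong[OF refl c_eq])
      then have "S = of_nat (card J) * S" unfolding S_def[symmetric] by simp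
      then have "of_nat (a * w) * S = 0" by (simp add: cardJ algebra_simps)
      then have "S = 0" using a_pos w_pos by simp
      then show False using c(1) c_eq by auto
    qed
  qed
qed

text \<open>The bound in the previous theorem is symmetric in cliques and independent sets, so it passes
  to the complement: this is the weak perfect graph theorem.\<close>

lemma chromatic_number_complement:
  assumes "finite V" "perfect_graph V E"
  shows "chromatic_number V (complement_edges V E) = independence_number V E"
proof -
  let ?C = "complement_edges V E"
  have cl: "clique_number W ?C = independence_number W E" if "W \<subseteq> V" for W
    unfolding clique_number_def independence_number_def using that
    by (intro arg_cong[where f = "\<lambda>S. Max (card ` S)"]) (auto simp: clique_complement_edges)
  have ind: "independence_number W ?C = clique_number W E" if "W \<subseteq> V" for W
    unfolding clique_number_def independence_number_def using that
    by (intro arg_cong[where f = "\<lambda>S. Max (card ` S)"]) (auto simp: indep_complement_edges)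
  obtain f where "proper_coloring ?C V (clique_number V ?C) f"
    using proper_coloring_of_card_le[OF assms(1), of ?C V] perfect_graph_card_le[OF assms]
    by (auto simp: cl ind mult.commute)
  then obtain P where "partition_on V P" "card P \<le> clique_number V ?C" "\<forall>A\<in>P. indep A ?C"
    using proper_coloring_partition by blast
  then have "chromatic_number V ?C \<le> clique_number V ?C"
    using chromatic_number_le by fastforce
  moreover have "clique_number V ?C \<le> chromatic_number V ?C"
    using ex_clique_number[OF assms(1), of ?C] ex_chromatic_number[of V ?C]
      card_clique_le_partition[OF assms(1)] by metis
  ultimately show ?thesis by (simp add: cl)
qed

section \<open>Prime ideals and Krull dimension\<close>

text \<open>A bridge from ideals in a ring record to type class arithmetic; closure under negation
  comes from multiplication by \<open>- 1\<close>.\<close>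

lemma ideal_of_type_algebra_iff:
  fixes I :: "'a::comm_ring_1 set"
  shows "ideal I ring_of_type_algebra \<longleftrightarrow>
    0 \<in> I \<and> (\<forall>x\<in>I. \<forall>y\<in>I. x + y \<in> I) \<and> (\<forall>x\<in>I. \<forall>r. r * x \<in> I)"
    (is "_ \<longleftrightarrow> ?rhs")
proof
  assume "ideal I ring_of_type_algebra"
  then interpret ideal I "ring_of_type_algebra :: 'a ring" .
  show ?rhs
    using additive_subgroup.zero_closed[OF is_additive_subgroup]
      additive_subgroup.a_closed[OF is_additive_subgroup] I_l_closed
    by (auto simp: ring_of_type_algebra_def)
next
  let ?R = "ring_of_type_algebra :: 'a ring"
  assume rhs: ?rhs
  interpret cring ?R by (rule cring_from_type_algebra)
  have neg: "- x \<in> I" if "x \<in> I" for x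
    using rhs that by (metis mult_minus1)
  have inv: "inv\<^bsub>add_monoid ?R\<^esub> x = - x" for x
  proof -
    have "\<ominus>\<^bsub>?R\<^esub> x = - x" by (rule minus_equality) (auto simp: ring_of_type_algebra_def)
    then show ?thesis by (simp add: a_inv_def)
  qed
  show "ideal I ?R"
  proof (rule idealI)
    show "ring ?R" by (rule ring_from_type_algebra)
    show "subgroup I (add_monoid ?R)"
      using rhs neg inv by (unfold_locales) (auto simp: ring_of_type_algebra_def)
  qed (use rhs in \<open>auto simp: ring_of_type_algebra_def mult.commute\<close>)
qed

lemma ideal_of_type_algebra_sum:
  fixes I :: "'a::comm_ring_1 set"
  assumes "ideal I ring_of_type_algebra" "\<And>x. x \<in> A \<Longrightarrow> f x \<in> I"
  shows "sum f A \<in> I"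
  using assms by (induction A rule: infinite_finite_induct) (auto simp: ideal_of_type_algebra_iff)

lemma primeideal_of_type_algebra_iff:
  fixes I :: "'a::comm_ring_1 set"
  shows "primeideal I ring_of_type_algebra \<longleftrightarrow>
    ideal I ring_of_type_algebra \<and> 1 \<notin> I \<and> (\<forall>x y. x * y \<in> I \<longrightarrow> x \<in> I \<or> y \<in> I)"
    (is "_ \<longleftrightarrow> ?rhs")
proof
  assume "primeideal I ring_of_type_algebra"
  then interpret primeideal I "ring_of_type_algebra :: 'a ring" .
  show ?rhs
    using is_ideal one_imp_carrier I_notcarr I_prime by (auto simp: ring_of_type_algebra_def)
next
  assume ?rhs
  then show "primeideal I ring_of_type_algebra"
    by (intro primeidealI cring_from_type_algebra) (auto simp: ring_of_type_algebra_def)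
qed

lemma genideal_of_type_algebra:
  fixes A :: "'a::comm_ring_1 set"
  shows ideal_genideal: "ideal (genideal ring_of_type_algebra A) ring_of_type_algebra"
    and genideal_superset: "A \<subseteq> genideal ring_of_type_algebra A"
    and genideal_least: "ideal J ring_of_type_algebra \<Longrightarrow> A \<subseteq> J \<Longrightarrow> genideal ring_of_type_algebra A \<subseteq> J"
proof -
  interpret cring "ring_of_type_algebra :: 'a ring" by (rule cring_from_type_algebra)
  have A: "A \<subseteq> carrier ring_of_type_algebra" by (simp add: ring_of_type_algebra_def)
  show "ideal (genideal ring_of_type_algebra A) ring_of_type_algebra" by (rule genideal_ideal[OF A])
  show "A \<subseteq> genideal ring_of_type_algebra A" by (rule genideal_self[OF A])
  show "genideal ring_of_type_algebra A \<subseteq> J" if "ideal J ring_of_type_algebra" "A \<subseteq> J"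
    by (rule genideal_minimal[OF that])
qed

lemma radical_ideal_of_type_algebra_iff:
  fixes I :: "'a::comm_ring_1 set"
  shows "x \<in> radical_ideal ring_of_type_algebra I \<longleftrightarrow> (\<exists>n>0. x ^ n \<in> I)"
proof -
  have "x [^]\<^bsub>ring_of_type_algebra\<^esub> n = x ^ n" for n :: nat
    by (induction n) (auto simp: ring_of_type_algebra_def nat_pow_def mult.commute)
  then show ?thesis by (simp add: radical_ideal_def) (simp add: ring_of_type_algebra_def)
qed

text \<open>For sums, each term of the binomial expansion of \<open>(x + y) ^ (n + m)\<close>
  contains \<open>x\<close> at least \<open>n\<close> times or \<open>y\<close> at least
  \<open>m\<close> times.\<close>

lemma ideal_radical_ideal:
  fixes I :: "'a::comm_ring_1 set"
  assumes I: "ideal I ring_of_type_algebra"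
  shows "ideal (radical_ideal ring_of_type_algebra I) ring_of_type_algebra"
  unfolding ideal_of_type_algebra_iff radical_ideal_of_type_algebra_iff
proof (intro conjI ballI allI)
  have mult: "r * x \<in> I" if "x \<in> I" for r x
    using I that by (simp add: ideal_of_type_algebra_iff)
  show "\<exists>n>0. 0 ^ n \<in> I"
    using I by (intro exI[of _ 1]) (simp add: ideal_of_type_algebra_iff)
  fix x assume "x \<in> radical_ideal ring_of_type_algebra I"
  then obtain n where n: "n > 0" "x ^ n \<in> I" by (auto simp: radical_ideal_of_type_algebra_iff)
  show "\<exists>n>0. (r * x) ^ n \<in> I" for r
    using n mult by (intro exI[of _ n]) (auto simp: power_mult_distrib)
  fix y assume "y \<in> radical_ideal ring_of_type_algebra I"
  then obtain m where m: "m > 0" "y ^ m \<in> I" by (auto simp: radical_ideal_of_type_algebra_iff)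
  have "of_nat (n + m choose k) * x ^ k * y ^ (n + m - k) \<in> I" if "k \<le> n + m" for k
  proof (cases "n \<le> k")
    case True
    have "(of_nat (n + m choose k) * y ^ (n + m - k) * x ^ (k - n)) * x ^ n \<in> I"
      by (intro mult n)
    also have "(of_nat (n + m choose k) * y ^ (n + m - k) * x ^ (k - n)) * x ^ n =
        of_nat (n + m choose k) * x ^ k * y ^ (n + m - k)"
      using True power_add[of x "k - n" n] by (simp add: mult_ac)
    finally show ?thesis .
  next
    case False
    have "(of_nat (n + m choose k) * x ^ k * y ^ (n - k)) * y ^ m \<in> I"
      by (intro mult m)
    also have "(of_nat (n + m choose k) * x ^ k * y ^ (n - k)) * y ^ m =
        of_nat (n + m choose k) * x ^ k * y ^ (n + m - k)"
      using False power_add[of y "n - k" m] by (simp add: mult_ac)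
    finally show ?thesis .
  qed
  then have "(x + y) ^ (n + m) \<in> I"
    unfolding binomial_ring by (intro ideal_of_type_algebra_sum[OF I]) auto
  then show "\<exists>n>0. (x + y) ^ n \<in> I" using n by (intro exI[of _ "n + m"]) auto
qed

text \<open>The correspondence theorem for primes: images and preimages under the projection are
  mutually inverse and preserve inclusion, so chains keep their length.\<close>

lemma krull_dim_Quot:
  fixes R (structure)
  assumes "cring R" "ideal I R"
  shows "krull_dim (R Quot I) = Sup {enat n | n. \<exists>P. (\<forall>i\<le>n. primeideal (P i) R \<and> I \<subseteq> P i) \<and>
    (\<forall>i<n. P i \<subset> P (Suc i))}"
proof -
  interpret cring R by fact
  interpret I: ideal I R by fact
  let ?Q = "R Quot I"
  have cr: "cring ?Q" by (rule I.quotient_is_cring) (rule \<open>cring R\<close>)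
  \<comment> \<open>Elements of the quotient are cosets, so \<open>?up J\<close> is the image of
    \<open>J\<close>, and the preimage of an ideal of the quotient is the union of its
    members.\<close>
  let ?up = "\<lambda>J. (+>) I ` J"
  note corr = quot_ideal_correspondence[OF assms(2)]
  have Union_up: "\<Union> (?up J) = J" if "ideal J R" "I \<subseteq> J" for J
    using ideal_incl_iff[OF assms(2) that(1)] that(2) by auto
  have mem_up: "I +> x \<in> ?up J \<longleftrightarrow> x \<in> J" if "ideal J R" "I \<subseteq> J" "x \<in> carrier R" for J x
    using canonical_proj_vimage_mem_iff[OF assms(2), of "?up J" x] Union_up[OF that(1,2)] that(3)
      ring_ideal_imp_quot_ideal[OF assms(2) that(1)]
    by (metis additive_subgroup.a_subset ideal.axioms(1))
  have carr: "\<exists>x\<in>carrier R. a = I +> x" if "a \<in> carrier ?Q" for a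
    using that by (auto simp: FactRing_def A_RCOSETS_def')
  have mult: "(I +> x) \<otimes>\<^bsub>?Q\<^esub> (I +> y) = I +> (x \<otimes>\<^bsub>R\<^esub> y)" if "x \<in> carrier R" "y \<in> carrier R" for x y
    using that by (simp add: FactRing_def I.rcoset_mult_add)
  have prime_up: "primeideal (?up J) ?Q" if "primeideal J R" "I \<subseteq> J" for J
  proof -
    interpret J: primeideal J R by fact
    note J = J.is_ideal that(2)
    show ?thesis
    proof (rule primeidealI[OF ring_ideal_imp_quot_ideal[OF assms(2) J.is_ideal] cr])
      obtain x where x: "x \<in> carrier R" "x \<notin> J" using J.I_notcarr J.a_subset by blast
      then have "I +> x \<in> carrier ?Q" by (auto simp: FactRing_def A_RCOSETS_def')
      then show "carrier ?Q \<noteq> ?up J" using mem_up[OF J x(1)] x(2) by blast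
    next
      fix a b assume ab: "a \<in> carrier ?Q" "b \<in> carrier ?Q" "a \<otimes>\<^bsub>?Q\<^esub> b \<in> ?up J"
      then obtain x y where xy: "x \<in> carrier R" "a = I +> x" "y \<in> carrier R" "b = I +> y"
        using carr by metis
      then have "x \<otimes>\<^bsub>R\<^esub> y \<in> J" using ab(3) mult mem_up[OF J, of "x \<otimes>\<^bsub>R\<^esub> y"] by simp
      then show "a \<in> ?up J \<or> b \<in> ?up J" using J.I_prime[of x y] xy by auto
    qed
  qed
  have prime_down: "primeideal (\<Union> J) R \<and> I \<subseteq> \<Union> J" if "primeideal J ?Q" for J
  proof -
    interpret J: primeideal J ?Q by fact
    have sub: "J \<subseteq> carrier ?Q" by (rule J.a_subset)
    have "\<Union> J = {r \<in> carrier R. I +> r \<in> J}"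
      using canonical_proj_vimage_in_carrier[OF assms(2) sub]
        canonical_proj_vimage_mem_iff[OF assms(2) sub] by blast
    moreover have "primeideal {r \<in> carrier R. I +> r \<in> J} R"
      using ring_hom_ring.primeideal_vimage[OF I.rcos_ring_hom_ring \<open>cring R\<close> that] .
    \<comment> \<open>The coset \<open>I\<close> is the zero of the quotient.\<close>
    moreover have "I \<in> J" using additive_subgroup.zero_closed[OF J.is_additive_subgroup] by (simp add: FactRing_def)
    ultimately show ?thesis by auto
  qed
  have inj_up: "inj_on ?up {J. ideal J R \<and> I \<subseteq> J}" using corr by (rule bij_betw_imp_inj_on)
  have up_Union: "?up (\<Union> J) = J" if "ideal J ?Q" for J
  proof -
    have "J \<in> ?up ` {K. ideal K R \<and> I \<subseteq> K}"
      unfolding bij_betw_imp_surj_on[OF corr] using that by simp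
    then obtain K where K: "ideal K R" "I \<subseteq> K" "J = ?up K" by auto
    then show ?thesis using Union_up[OF K(1,2)] by simp
  qed
  have "(\<exists>P. (\<forall>i\<le>n. primeideal (P i) ?Q) \<and> (\<forall>i<n. P i \<subset> P (Suc i))) \<longleftrightarrow>
    (\<exists>P. (\<forall>i\<le>n. primeideal (P i) R \<and> I \<subseteq> P i) \<and> (\<forall>i<n. P i \<subset> P (Suc i)))" (is "?L \<longleftrightarrow> ?R") for n :: nat
  proof
    assume ?L
    then obtain P where P: "\<forall>i\<le>n. primeideal (P i) ?Q" "\<forall>i<n. P i \<subset> P (Suc i)" by blast
    have "\<Union> (P i) \<subset> \<Union> (P (Suc i))" if "i < n" for i
    proof -
      have "ideal (P i) ?Q" "ideal (P (Suc i)) ?Q" using P(1) that by (auto intro: primeideal.axioms)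
      then have "\<Union> (P i) \<noteq> \<Union> (P (Suc i))" using up_Union P(2) that by (metis psubset_eq)
      then show ?thesis using P(2) that by blast
    qed
    then show ?R using P(1) prime_down by (intro exI[of _ "\<lambda>i. \<Union> (P i)"]) auto
  next
    assume ?R
    then obtain P where P: "\<forall>i\<le>n. primeideal (P i) R \<and> I \<subseteq> P i" "\<forall>i<n. P i \<subset> P (Suc i)" by blast
    have "?up (P i) \<subset> ?up (P (Suc i))" if "i < n" for i
    proof -
      have m: "P i \<in> {J. ideal J R \<and> I \<subseteq> J}" "P (Suc i) \<in> {J. ideal J R \<and> I \<subseteq> J}"
        using P(1) that by (auto intro: primeideal.axioms(1))
      have "P i \<noteq> P (Suc i)" using P(2) that by blast
      then have "?up (P i) \<noteq> ?up (P (Suc i))" unfolding inj_on_eq_iff[OF inj_up m] .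
      moreover have "?up (P i) \<subseteq> ?up (P (Suc i))" using P(2) that by (intro image_mono) blast
      ultimately show ?thesis by (simp add: psubset_eq)
    qed
    then show ?L using P(1) prime_up by (intro exI[of _ "\<lambda>i. ?up (P i)"]) auto
  qed
  then show ?thesis by (simp add: krull_dim_def)
qed

text \<open>The lexicographically smallest monomial of a relation survives: dividing by the highest
  possible power of \<open>a\<^sub>s\<close> and reducing modulo \<open>P\<^sub>s\<^sub>+\<^sub>1\<close> kills exactly the terms in which
  \<open>a\<^sub>s\<close> occurs to a larger power.\<close>

lemma prime_chain_no_relation:
  fixes P :: "nat \<Rightarrow> 'a::comm_ring_1 set" and a :: "nat \<Rightarrow> 'a" and c :: "(nat \<Rightarrow> nat) \<Rightarrow> 'a"
  assumes prime: "\<And>i. i \<le> n \<Longrightarrow> primeideal (P i) ring_of_type_algebra"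
    and chain: "\<And>i. i < n \<Longrightarrow> P i \<subseteq> P (Suc i)"
    and a: "\<And>i. i < n \<Longrightarrow> a i \<in> P (Suc i) - P i"
    and unit: "\<And>e. e \<in> J \<Longrightarrow> c e dvd 1"
    and "s \<le> n" "finite J" "J \<noteq> {}"
    and agree: "\<And>e e' i. e \<in> J \<Longrightarrow> e' \<in> J \<Longrightarrow> i \<notin> {s..<n} \<Longrightarrow> e i = e' i"
  shows "(\<Sum>e\<in>J. c e * (\<Prod>i\<in>{s..<n}. a i ^ e i)) \<notin> P s"
  using assms(5,6,7) unit agree
proof (induction s arbitrary: J rule: inc_induct)
  \<comment> \<open>For \<open>s = n\<close> all exponent vectors agree, so the sum is a single
    unit, which lies in no prime ideal.\<close>
  case base
  then obtain e where e: "e \<in> J" by blast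
  have "e' = e" if "e' \<in> J" for e' using base.prems(4)[OF that e] by fastforce
  then have "J = {e}" using e by blast
  then show ?case
    using base.prems(3)[of e] prime[of n]
    by (auto simp: primeideal_of_type_algebra_iff ideal_of_type_algebra_iff dvd_def) (metis mult.commute)
next
  case (step s)
  \<comment> \<open>\<open>k\<close> is the highest power of \<open>a s\<close> dividing every
    displayed term, and \<open>K\<close> below collects the terms where it is attained.\<close>
  define k where "k = Min ((\<lambda>e. e s) ` J)"
  have k_le: "k \<le> e s" if "e \<in> J" for e
    using step.prems(1) that by (simp add: k_def)
  have "k \<in> (\<lambda>e. e s) ` J" using step.prems by (simp add: k_def)
  define K where "K = {e \<in> J. e s = k}"
  have K: "K \<subseteq> J" "finite K" "K \<noteq> {}"
    using step.prems \<open>k \<in> _\<close> by (auto simp: K_def)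
  let ?m = "\<lambda>e. c e * (\<Prod>i\<in>{Suc s..<n}. a i ^ e i)"
  \<comment> \<open>\<open>t\<close> is what remains of the other terms after
    \<open>a s ^ (k + 1)\<close> has been taken out.\<close>
  define t where "t = (\<Sum>e\<in>J - K. ?m e * a s ^ (e s - k - 1))"
  note ps = prime[of s, unfolded primeideal_of_type_algebra_iff ideal_of_type_algebra_iff]
    and pS = prime[of "Suc s", unfolded primeideal_of_type_algebra_iff ideal_of_type_algebra_iff]
  show ?case
  proof
    assume mem: "(\<Sum>e\<in>J. c e * (\<Prod>i\<in>{s..<n}. a i ^ e i)) \<in> P s"
    have "(\<Sum>e\<in>J. c e * (\<Prod>i\<in>{s..<n}. a i ^ e i)) = (\<Sum>e\<in>J. a s ^ e s * ?m e)"
      using step.hyps by (intro sum.cong) (auto simp: prod.atLeast_Suc_lessThan mult_ac)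
    also have "\<dots> = (\<Sum>e\<in>K. a s ^ e s * ?m e) + (\<Sum>e\<in>J - K. a s ^ e s * ?m e)"
      using step.prems(1) K(1) by (simp add: sum.subset_diff add.commute)
    also have "(\<Sum>e\<in>K. a s ^ e s * ?m e) = a s ^ k * sum ?m K"
      by (simp add: K_def sum_distrib_left)
    also have "(\<Sum>e\<in>J - K. a s ^ e s * ?m e) = a s ^ k * (a s * t)"
    proof -
      have "a s ^ e s * ?m e = a s ^ k * (a s * (?m e * a s ^ (e s - k - 1)))" if "e \<in> J - K" for e
      proof -
        have "e s = k + (1 + (e s - k - 1))" using k_le[of e] that by (auto simp: K_def)
        then have "a s ^ e s = a s ^ k * (a s * a s ^ (e s - k - 1))"
          by (metis power_add power_one_right)
        then show ?thesis by (simp add: mult_ac)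
      qed
      then show ?thesis by (simp add: t_def sum_distrib_left)
    qed
    finally have "a s ^ k * (sum ?m K + a s * t) \<in> P s"
      using mem by (simp add: distrib_left)
    \<comment> \<open>\<open>a s\<close> lies outside the prime \<open>P s\<close>, so the factor
      \<open>a s ^ k\<close> can be cancelled.\<close>
    moreover have "a s ^ k \<notin> P s"
    proof (induction k)
      case 0
      show ?case using ps step.hyps by simp
    next
      case (Suc k)
      then show ?case using a[OF step.hyps(2)] ps step.hyps by fastforce
    qed
    ultimately have "sum ?m K + a s * t \<in> P s"
      using ps step.hyps by (meson less_imp_le)
    then have "sum ?m K + a s * t \<in> P (Suc s)" using chain[OF step.hyps(2)] by blast
    moreover have "(- t) * a s \<in> P (Suc s)"
    proof -
      have "\<forall>x\<in>P (Suc s). \<forall>r. r * x \<in> P (Suc s)" using pS step.hyps by simp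
      then show ?thesis using a[OF step.hyps(2)] by blast
    qed
    moreover have "\<forall>x\<in>P (Suc s). \<forall>y\<in>P (Suc s). x + y \<in> P (Suc s)"
      using pS step.hyps by simp
    ultimately have "(sum ?m K + a s * t) + (- t) * a s \<in> P (Suc s)" by blast
    then have "sum ?m K \<in> P (Suc s)" by (simp add: algebra_simps)
    moreover have "sum ?m K \<notin> P (Suc s)"
    \<comment> \<open>The exponent at \<open>s\<close> is constantly \<open>k\<close> on
      \<open>K\<close>, so the vectors in \<open>K\<close> agree outside
      \<open>{Suc s..<n}\<close>.\<close>
    proof (rule step.IH[OF K(2,3)])
      show "c e dvd 1" if "e \<in> K" for e using that K(1) step.prems(3) by blast
      show "e i = e' i" if "e \<in> K" "e' \<in> K" "i \<notin> {Suc s..<n}" for e e' i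
        using that step.prems(4)[of e e' i] by (cases "i = s") (auto simp: K_def)
    qed
    ultimately show False by blast
  qed
qed

section \<open>The polynomial ring\<close>

lemma poly_eq_sum_single: "p = (\<Sum>m\<in>Poly_Mapping.keys p. Poly_Mapping.single m (Poly_Mapping.lookup p m))"
proof (rule poly_mapping_eqI)
  fix k
  have "(\<Sum>m\<in>Poly_Mapping.keys p. Poly_Mapping.lookup (Poly_Mapping.single m (Poly_Mapping.lookup p m)) k)
    = (\<Sum>m\<in>Poly_Mapping.keys p. if m = k then Poly_Mapping.lookup p k else 0)"
    by (intro sum.cong) (auto simp: lookup_single when_def)
  then show "Poly_Mapping.lookup p k =
      Poly_Mapping.lookup (\<Sum>m\<in>Poly_Mapping.keys p. Poly_Mapping.single m (Poly_Mapping.lookup p m)) k"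
    by (simp add: lookup_sum in_keys_iff)
qed

lemma lookup_mult_keys:
  "Poly_Mapping.lookup (p * q) k =
    (\<Sum>a\<in>Poly_Mapping.keys p. \<Sum>b\<in>Poly_Mapping.keys q.
      if a + b = k then Poly_Mapping.lookup p a * Poly_Mapping.lookup q b else 0)"
proof -
  have "p * q = (\<Sum>a\<in>Poly_Mapping.keys p. \<Sum>b\<in>Poly_Mapping.keys q.
      Poly_Mapping.single (a + b) (Poly_Mapping.lookup p a * Poly_Mapping.lookup q b))"
    by (subst (1) poly_eq_sum_single[of p], subst (1) poly_eq_sum_single[of q])
      (simp add: sum_product mult_single)
  then show ?thesis by (simp add: lookup_sum lookup_single when_def)
qed

lemma lookup_const_mult: "Poly_Mapping.lookup (Poly_Mapping.single 0 c * p) m = c * Poly_Mapping.lookup p m"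
  by (simp add: mult_map_scale_conv_mult[symmetric] Poly_Mapping.map.rep_eq when_def)

lemma single_mult_Var:
  assumes "v \<in> Poly_Mapping.keys m"
  shows "Poly_Mapping.single m c = Poly_Mapping.single (m - Poly_Mapping.single v 1) c * Var v"
proof -
  have "m - Poly_Mapping.single v 1 + Poly_Mapping.single v 1 = m"
    using assms by (intro poly_mapping_eqI) (auto simp: lookup_add lookup_minus lookup_single when_def in_keys_iff)
  then show ?thesis by (simp add: Var_def mult_single)
qed

text \<open>Exponents are natural numbers and cannot cancel.\<close>

lemma keys_plus_nat: "Poly_Mapping.keys (m + m' :: 'v \<Rightarrow>\<^sub>0 nat) = Poly_Mapping.keys m \<union> Poly_Mapping.keys m'"
  by (auto simp: in_keys_iff lookup_add)

section \<open>Ideals generated by variables\<close>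

text \<open>This is the ideal generated by the variables in \<open>B\<close>, described so that
  membership can be read off each monomial.\<close>

definition variable_ideal :: "'v set \<Rightarrow> ('v, 'k::field) mpoly set" where
  "variable_ideal B = {p. \<forall>m \<in> Poly_Mapping.keys p. Poly_Mapping.keys m \<inter> B \<noteq> {}}"

lemma Var_in_variable_ideal_iff: "(Var v :: ('v, 'k::field) mpoly) \<in> variable_ideal B \<longleftrightarrow> v \<in> B"
  by (simp add: variable_ideal_def Var_def)

lemma variable_ideal_mono: "B \<subseteq> C \<Longrightarrow> variable_ideal B \<subseteq> variable_ideal C"
  by (auto simp: variable_ideal_def)

lemma ideal_variable_ideal: "ideal (variable_ideal B :: ('v, 'k::field) mpoly set) poly_ring"
  unfolding ideal_of_type_algebra_iff
proof (intro conjI ballI allI)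
  fix x y :: "('v, 'k) mpoly" assume "x \<in> variable_ideal B" "y \<in> variable_ideal B"
  then show "x + y \<in> variable_ideal B"
    using keys_add[of x y] by (auto simp: variable_ideal_def)
next
  fix x r :: "('v, 'k) mpoly" assume "x \<in> variable_ideal B"
  then show "r * x \<in> variable_ideal B"
    using keys_mult[of r x] by (fastforce simp: variable_ideal_def keys_plus_nat)
qed (simp add: variable_ideal_def)

text \<open>Every monomial of such a polynomial is a multiple of a variable in
  \<open>B\<close>.\<close>

lemma variable_ideal_subset:
  fixes I :: "('v, 'k::field) mpoly set"
  assumes I: "ideal I poly_ring" and "Var ` B \<subseteq> I"
  shows "variable_ideal B \<subseteq> I"
proof
  fix p :: "('v, 'k) mpoly" assume p: "p \<in> variable_ideal B"
  have "Poly_Mapping.single m (Poly_Mapping.lookup p m) \<in> I" if m: "m \<in> Poly_Mapping.keys p" for m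
  proof -
    obtain v where "v \<in> Poly_Mapping.keys m" "v \<in> B" using p m by (auto simp: variable_ideal_def)
    then show ?thesis
      using assms by (subst single_mult_Var[of v]) (auto simp: ideal_of_type_algebra_iff)
  qed
  then show "p \<in> I" by (subst poly_eq_sum_single) (intro ideal_of_type_algebra_sum[OF I])
qed

lemma irrelevant_ideal_eq: "(irrelevant_ideal :: ('v, 'k::field) mpoly set) = variable_ideal UNIV"
proof
  show "(irrelevant_ideal :: ('v, 'k) mpoly set) \<subseteq> variable_ideal UNIV"
    unfolding irrelevant_ideal_def
    by (intro genideal_least ideal_variable_ideal) (auto simp: Var_in_variable_ideal_iff)
  show "variable_ideal UNIV \<subseteq> (irrelevant_ideal :: ('v, 'k) mpoly set)"
    unfolding irrelevant_ideal_def
    by (intro variable_ideal_subset ideal_genideal genideal_superset)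
qed

text \<open>Since \<open>'v\<close> carries no order, monomials are compared after renaming the variables to natural
  numbers; the largest monomials without variables in \<open>B\<close> cannot cancel in a product.\<close>

lemma primeideal_variable_ideal:
  "primeideal (variable_ideal B :: ('v::finite, 'k::field) mpoly set) poly_ring"
  unfolding primeideal_of_type_algebra_iff
proof (intro conjI allI impI)
  show "ideal (variable_ideal B :: ('v, 'k) mpoly set) poly_ring" by (rule ideal_variable_ideal)
  show "(1 :: ('v, 'k) mpoly) \<notin> variable_ideal B" by (simp add: variable_ideal_def)
  obtain r :: "'v \<Rightarrow> nat" where r: "inj r" using finite_imp_inj_to_nat_seg[of "UNIV :: 'v set"] by auto
  define w :: "('v \<Rightarrow>\<^sub>0 nat) \<Rightarrow> (nat \<Rightarrow>\<^sub>0 nat)" where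
    "w m = (\<Sum>v\<in>UNIV. Poly_Mapping.single (r v) (Poly_Mapping.lookup m v))" for m
  have w_add: "w (m + m') = w m + w m'" for m m'
    by (simp add: w_def lookup_add single_add sum.distrib)
  have lookup_w: "Poly_Mapping.lookup (w m) (r v) = Poly_Mapping.lookup m v" for m v
  proof -
    have "Poly_Mapping.lookup (w m) (r v) = (\<Sum>u\<in>UNIV. if u = v then Poly_Mapping.lookup m v else 0)"
      unfolding w_def lookup_sum
      by (intro sum.cong) (auto simp: lookup_single when_def inj_eq[OF r])
    then show ?thesis by simp
  qed
  then have w_inj: "m = m'" if "w m = w m'" for m m'
    using that by (intro poly_mapping_eqI) metis
  fix p q :: "('v, 'k) mpoly"
  \<comment> \<open>The monomials that keep \<open>p\<close> out of the ideal.\<close>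
  let ?K = "\<lambda>p :: ('v, 'k) mpoly. {m \<in> Poly_Mapping.keys p. Poly_Mapping.keys m \<inter> B = {}}"
  have top: "\<exists>m\<in>?K p. \<forall>m'\<in>?K p. w m' \<le> w m" if "p \<notin> variable_ideal B" for p :: "('v, 'k) mpoly"
  proof -
    have "?K p \<noteq> {}" using that by (auto simp: variable_ideal_def)
    then have "Max (w ` ?K p) \<in> w ` ?K p" by (intro Max_in) auto
    then obtain m where "m \<in> ?K p" "Max (w ` ?K p) = w m" by blast
    moreover have "\<forall>m'\<in>?K p. w m' \<le> Max (w ` ?K p)" by (intro ballI Max_ge) auto
    ultimately show ?thesis by (intro bexI[of _ m]) simp_all
  qed
  assume pq: "p * q \<in> variable_ideal B"
  show "p \<in> variable_ideal B \<or> q \<in> variable_ideal B"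
  proof (rule ccontr)
    assume "\<not> (p \<in> variable_ideal B \<or> q \<in> variable_ideal B)"
    then have "p \<notin> variable_ideal B" "q \<notin> variable_ideal B" by blast+
    obtain a where a: "a \<in> ?K p" "\<forall>m\<in>?K p. w m \<le> w a"
      using top[OF \<open>p \<notin> _\<close>] by (rule bexE)
    obtain b where b: "b \<in> ?K q" "\<forall>m\<in>?K q. w m \<le> w b"
      using top[OF \<open>q \<notin> _\<close>] by (rule bexE)
    \<comment> \<open>Equal products have equal supports, so \<open>a'\<close> and \<open>b'\<close>
      avoid \<open>B\<close> too; as neither exceeds its maximal counterpart, equality of the sums
      forces equality of both.\<close>
    have uniq: "a' = a \<and> b' = b"
      if "a' \<in> Poly_Mapping.keys p" "b' \<in> Poly_Mapping.keys q" "a' + b' = a + b" for a' b'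
    proof -
      have "Poly_Mapping.keys a' \<union> Poly_Mapping.keys b' = Poly_Mapping.keys a \<union> Poly_Mapping.keys b"
        using that(3) keys_plus_nat by metis
      then have "a' \<in> ?K p" "b' \<in> ?K q" using a(1) b(1) that by auto
      then have le: "w a' \<le> w a" "w b' \<le> w b" using a(2) b(2) by blast+
      have eq: "w a' + w b' = w a + w b" using that(3) w_add by metis
      have "w a' = w a"
      proof (rule ccontr)
        assume "w a' \<noteq> w a"
        then have "w a' + w b' < w a + w b" using le by (intro add_less_le_mono) auto
        then show False using eq by simp
      qed
      then have "w b' = w b" using eq by simp
      with \<open>w a' = w a\<close> show ?thesis using w_inj by blast
    qed
    have "Poly_Mapping.lookup (p * q) (a + b) =
        (\<Sum>a'\<in>Poly_Mapping.keys p. \<Sum>b'\<in>Poly_Mapping.keys q.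
          if a' = a \<and> b' = b then Poly_Mapping.lookup p a * Poly_Mapping.lookup q b else 0)"
      unfolding lookup_mult_keys using uniq by (intro sum.cong refl) auto
    also have "\<dots> = (\<Sum>a'\<in>Poly_Mapping.keys p. if a' = a then
        \<Sum>b'\<in>Poly_Mapping.keys q.
          if b' = b then Poly_Mapping.lookup p a * Poly_Mapping.lookup q b else 0 else 0)"
      by (intro sum.cong) auto
    also have "\<dots> = Poly_Mapping.lookup p a * Poly_Mapping.lookup q b"
      using a(1) b(1) by simp
    also have "\<dots> \<noteq> 0" using a(1) b(1) by (simp add: in_keys_iff)
    finally have "a + b \<in> Poly_Mapping.keys (p * q)" by (simp add: in_keys_iff)
    then have "Poly_Mapping.keys (a + b) \<inter> B \<noteq> {}" using pq by (auto simp: variable_ideal_def)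
    then show False using a(1) b(1) by (auto simp: keys_plus_nat)
  qed
qed

section \<open>Bounded exponents and the length of prime chains\<close>

text \<open>Each exponent is bounded separately, in place of the total degree, so that the monomials
  form a box that is easy to count.\<close>

definition exponents_le :: "nat \<Rightarrow> ('v, 'k::field) mpoly \<Rightarrow> bool" where
  "exponents_le L p \<longleftrightarrow> (\<forall>m\<in>Poly_Mapping.keys p. \<forall>v. Poly_Mapping.lookup m v \<le> L)"

lemma exponents_le_mono: "exponents_le L p \<Longrightarrow> L \<le> L' \<Longrightarrow> exponents_le L' p"
  unfolding exponents_le_def by (meson order_trans)

lemma exponents_le_mult: "exponents_le L p \<Longrightarrow> exponents_le L' q \<Longrightarrow> exponents_le (L + L') (p * q)"
  using keys_mult[of p q] by (fastforce simp: exponents_le_def lookup_add intro: add_mono)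

lemma exponents_le_one: "exponents_le L 1"
  by (simp add: exponents_le_def)

lemma exponents_le_power: "exponents_le L p \<Longrightarrow> exponents_le (n * L) (p ^ n)"
  by (induction n) (auto intro: exponents_le_mult exponents_le_one)

lemma exponents_le_prod:
  "finite A \<Longrightarrow> (\<And>i. i \<in> A \<Longrightarrow> exponents_le (L i) (f i)) \<Longrightarrow> exponents_le (sum L A) (prod f A)"
  by (induction A rule: finite_induct) (auto intro: exponents_le_mult exponents_le_one)

lemma ex_exponents_le: "\<exists>L. exponents_le L (p :: ('v::finite, 'k::field) mpoly)"
proof -
  let ?S = "(\<lambda>(m, v). Poly_Mapping.lookup m v) ` (Poly_Mapping.keys p \<times> UNIV)"
  have "exponents_le (Max ?S) p"
    unfolding exponents_le_def by (intro ballI allI Max_ge) auto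
  then show ?thesis by blast
qed

text \<open>Restriction to \<open>A\<close> embeds these monomials into the functions from
  \<open>A\<close> to \<open>{..L}\<close>.\<close>

lemma finite_card_monomials:
  fixes A :: "'v::finite set" and L :: nat
  defines "Z \<equiv> {m :: 'v \<Rightarrow>\<^sub>0 nat. Poly_Mapping.keys m \<subseteq> A \<and> (\<forall>v. Poly_Mapping.lookup m v \<le> L)}"
  shows "finite Z" "card Z \<le> (L + 1) ^ card A"
proof -
  let ?f = "\<lambda>m. restrict (Poly_Mapping.lookup m) A"
  have inj: "inj_on ?f Z"
  proof (rule inj_onI)
    fix m m' assume m: "m \<in> Z" "m' \<in> Z" and eq: "?f m = ?f m'"
    show "m = m'"
    proof (rule poly_mapping_eqI)
      fix v
      show "Poly_Mapping.lookup m v = Poly_Mapping.lookup m' v"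
      proof (cases "v \<in> A")
        case True
        then show ?thesis using fun_cong[OF eq, of v] by simp
      next
        case False
        then have "v \<notin> Poly_Mapping.keys m" "v \<notin> Poly_Mapping.keys m'" using m by (auto simp: Z_def)
        then show ?thesis by (simp add: in_keys_iff)
      qed
    qed
  qed
  have img: "?f ` Z \<subseteq> (\<Pi>\<^sub>E v\<in>A. {..L})" by (auto simp: Z_def)
  have fin: "finite (\<Pi>\<^sub>E v\<in>A. {..L})" by (intro finite_PiE) auto
  show "finite Z" using inj img fin by (meson finite_imageD finite_subset)
  have "card Z \<le> card (\<Pi>\<^sub>E v\<in>A. {..L})" using inj img fin by (rule card_inj_on_le)
  then show "card Z \<le> (L + 1) ^ card A" by (simp add: card_PiE)
qed

text \<open>Modulo \<open>P 0\<close> only monomials in the variables of \<open>A\<close> matter. In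
  a longer chain they would be outnumbered by the products \<open>q e\<close> of separating
  elements, and the resulting relation contradicts \<open>prime_chain_no_relation\<close>.\<close>

lemma prime_chain_length_le:
  fixes P :: "nat \<Rightarrow> ('v::finite, 'k::field) mpoly set"
  assumes prime: "\<And>i. i \<le> n \<Longrightarrow> primeideal (P i) poly_ring"
    and chain: "\<And>i. i < n \<Longrightarrow> P i \<subset> P (Suc i)"
  shows "n \<le> card {v. Var v \<notin> P 0}"
proof (rule ccontr)
  define A where "A = {v. Var v \<notin> P 0}"
  assume "\<not> ?thesis"
  then have less: "card A < n" by (simp add: A_def)
  have "\<forall>i\<in>{..<n}. \<exists>a. a \<in> P (Suc i) - P i" using chain by blast
  then obtain a where a: "\<And>i. i < n \<Longrightarrow> a i \<in> P (Suc i) - P i"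
    by (metis lessThan_iff)
  have "\<forall>i. \<exists>L. exponents_le L (a i)" using ex_exponents_le by blast
  then obtain l where l: "\<And>i. exponents_le (l i) (a i)" by metis
  define D where "D = (\<Sum>i<n. l i)"
  have D: "exponents_le D (a i)" if "i < n" for i
    using that by (intro exponents_le_mono[OF l]) (auto simp: D_def intro: member_le_sum)
  \<comment> \<open>The products use exponents up to \<open>N\<close>, so \<open>L\<close> bounds
    the exponents of their monomials. The choice of \<open>N\<close> gives
    \<open>(L + 1) ^ card A \<le> N * (N + 1) ^ card A < (N + 1) ^ n\<close>.\<close>
  define N where "N = (n * D + 1) ^ card A"
  define L where "L = n * (N * D)"
  define Z where
    "Z = {m :: 'v \<Rightarrow>\<^sub>0 nat. Poly_Mapping.keys m \<subseteq> A \<and> (\<forall>v. Poly_Mapping.lookup m v \<le> L)}"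
  \<comment> \<open>Functions in \<open>PiE\<close> have a fixed value outside
    \<open>{0..<n}\<close>, which later yields the agreement that
    \<open>prime_chain_no_relation\<close> asks for.\<close>
  define J where "J = (\<Pi>\<^sub>E i\<in>{0..<n}. {..N})"
  define q where "q e = (\<Prod>i\<in>{0..<n}. a i ^ e i)" for e
  have finJ: "finite J" unfolding J_def by (intro finite_PiE) auto
  have "card J = (N + 1) ^ n" by (simp add: J_def card_PiE)
  have "card Z \<le> (L + 1) ^ card A" using finite_card_monomials(2)[of A L] by (simp add: Z_def)
  also have "\<dots> \<le> ((n * D + 1) * (N + 1)) ^ card A"
    by (intro power_mono) (auto simp: L_def algebra_simps)
  also have "\<dots> = N * (N + 1) ^ card A" by (simp only: power_mult_distrib N_def[symmetric])
  also have "\<dots> < (N + 1) ^ Suc (card A)" by simp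
  also have "\<dots> \<le> (N + 1) ^ n" using less by (intro power_increasing) auto
  finally have "card Z < card J" using \<open>card J = _\<close> by simp
  then obtain c where c: "\<exists>e\<in>J. c e \<noteq> 0" "\<forall>m\<in>Z. (\<Sum>e\<in>J. c e * Poly_Mapping.lookup (q e) m) = 0"
    using nontrivial_linear_relation[of Z J "\<lambda>m e. Poly_Mapping.lookup (q e) m"]
      finite_card_monomials(1)[of A L] finJ by (auto simp: Z_def)
  \<comment> \<open>On \<open>K\<close> the coefficients are nonzero scalars, hence units of the
    polynomial ring.\<close>
  define K where "K = {e \<in> J. c e \<noteq> 0}"
  define r where "r = (\<Sum>e\<in>K. Poly_Mapping.single 0 (c e) * q e)"
  have lookup_r: "Poly_Mapping.lookup r m = (\<Sum>e\<in>J. c e * Poly_Mapping.lookup (q e) m)" for m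
    unfolding r_def lookup_sum lookup_const_mult K_def
    using finJ by (intro sum.mono_neutral_left) auto
  have q_bound: "exponents_le L (q e)" if "e \<in> J" for e
  proof -
    have "exponents_le (\<Sum>i\<in>{0..<n}. e i * D) (q e)"
      unfolding q_def using D by (intro exponents_le_prod exponents_le_power) auto
    moreover have "(\<Sum>i\<in>{0..<n}. e i * D) \<le> (\<Sum>i\<in>{0..<n}. N * D)"
      using that by (intro sum_mono mult_right_mono) (auto simp: J_def PiE_iff)
    ultimately show ?thesis by (auto simp: L_def intro: exponents_le_mono)
  qed
  note P0 = prime[of 0, unfolded primeideal_of_type_algebra_iff]
  \<comment> \<open>A monomial of \<open>r\<close> has exponents at most \<open>L\<close> but lies
    outside \<open>Z\<close>, where the coefficients vanish. It therefore involves a variable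
    outside \<open>A\<close>, that is, one in \<open>P 0\<close>.\<close>
  have "Poly_Mapping.single m (Poly_Mapping.lookup r m) \<in> P 0" if m: "m \<in> Poly_Mapping.keys r" for m
  proof -
    have nz: "Poly_Mapping.lookup r m \<noteq> 0" using m by (simp add: in_keys_iff)
    then have "m \<notin> Z" using c(2) lookup_r by auto
    moreover obtain e where "e \<in> J" "Poly_Mapping.lookup (q e) m \<noteq> 0"
      using nz unfolding lookup_r by (metis (no_types, lifting) mult_zero_right sum.neutral)
    then have "\<forall>v. Poly_Mapping.lookup m v \<le> L"
      using q_bound by (simp add: exponents_le_def in_keys_iff)
    ultimately obtain v where "v \<in> Poly_Mapping.keys m" "v \<notin> A" by (auto simp: Z_def)
    moreover from this have "Var v \<in> P 0" by (simp add: A_def)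
    ultimately show ?thesis
      using P0 by (subst single_mult_Var[of v]) (auto simp: ideal_of_type_algebra_iff)
  qed
  then have "r \<in> P 0"
    using P0 by (subst poly_eq_sum_single) (auto intro: ideal_of_type_algebra_sum)
  moreover have "(\<Sum>e\<in>K. Poly_Mapping.single 0 (c e) * (\<Prod>i\<in>{0..<n}. a i ^ e i)) \<notin> P 0"
  proof (rule prime_chain_no_relation[of n P a K "\<lambda>e. Poly_Mapping.single 0 (c e)"])
    show "finite K" "K \<noteq> {}" using finJ c(1) by (auto simp: K_def)
    show "Poly_Mapping.single 0 (c e) dvd (1 :: ('v, 'k) mpoly)" if "e \<in> K" for e
    proof
      show "1 = Poly_Mapping.single 0 (c e) * Poly_Mapping.single 0 (inverse (c e))"
        using that by (simp add: K_def mult_single)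
    qed
    show "e i = e' i" if "e \<in> K" "e' \<in> K" "i \<notin> {0..<n}" for e e' i
      using that by (auto simp: K_def J_def PiE_def extensional_def)
  qed (use prime chain a in auto)
  ultimately show False by (simp add: r_def q_def)
qed

section \<open>Edge ideals\<close>

lemma edge_product_in_edge_ideal:
  "{u, v} \<in> E \<Longrightarrow> Var u * Var v \<in> (edge_ideal E :: ('v, 'k::field) mpoly set)"
  unfolding edge_ideal_def by (intro subsetD[OF genideal_superset]) blast

lemma ideal_edge_ideal: "ideal (edge_ideal E :: ('v, 'k::field) mpoly set) poly_ring"
  unfolding edge_ideal_def by (rule ideal_genideal)

text \<open>The complement of \<open>B\<close> being independent, \<open>B\<close> is a vertex
  cover, and each generator has a factor in it.\<close>

lemma edge_ideal_subset_variable_ideal: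
  assumes "indep (- B) E" and "E \<subseteq> nsets UNIV 2"
  shows "(edge_ideal E :: ('v, 'k::field) mpoly set) \<subseteq> variable_ideal B"
  unfolding edge_ideal_def
proof (rule genideal_least[OF ideal_variable_ideal], safe)
  fix u v assume uv: "{u, v} \<in> E"
  \<comment> \<open>\<open>indep\<close> does not exclude loops, so the distinctness of the ends is
    taken from the edges being two-element sets.\<close>
  then have "u \<noteq> v" using assms(2) by (auto simp: nsets_def)
  then have "u \<in> B \<or> v \<in> B" using assms(1) uv by (auto simp: indep_def)
  then show "Var u * Var v \<in> (variable_ideal B :: ('v, 'k) mpoly set)"
    by (auto simp: variable_ideal_def Var_def mult_single keys_plus_nat)
qed

theorem krull_dim_edge_ideal:
  fixes E :: "'v::finite set set"
  assumes "simple_graph UNIV E"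
  shows "krull_dim (poly_ring Quot (edge_ideal E :: ('v, 'k::field) mpoly set)) =
    enat (independence_number UNIV E)"
proof -
  let ?I = "edge_ideal E :: ('v, 'k) mpoly set" and ?d = "independence_number UNIV E"
  let ?S = "{enat n | n. \<exists>P. (\<forall>i\<le>n. primeideal (P i) poly_ring \<and> ?I \<subseteq> P i) \<and>
    (\<forall>i<n. P i \<subset> P (Suc i))}"
  have E: "E \<subseteq> nsets UNIV 2" using assms by (simp add: simple_graph_def)
  have "Sup ?S = enat ?d"
  proof (rule antisym[OF Sup_least Sup_upper])
    fix x assume "x \<in> ?S"
    then obtain n P where x: "x = enat n"
      and P: "\<And>i. i \<le> n \<Longrightarrow> primeideal (P i) poly_ring" "?I \<subseteq> P 0" "\<And>i. i < n \<Longrightarrow> P i \<subset> P (Suc i)"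
      by blast
    \<comment> \<open>A prime containing the product of two adjacent variables contains one of
      them.\<close>
    have "indep {v. Var v \<notin> P 0} E"
      using edge_product_in_edge_ideal[of _ _ E] P(2) P(1)[of 0]
      unfolding indep_def primeideal_of_type_algebra_iff by blast
    then have "card {v. Var v \<notin> P 0} \<le> ?d" by (intro card_le_independence_number) auto
    then show "x \<le> enat ?d" using prime_chain_length_le[of n P, OF P(1,3)] x by simp
  next
    obtain A :: "'v set" where A: "indep A E" "card A = ?d"
      using ex_independence_number[of UNIV E] by auto
    obtain g where g: "bij_betw g {0..<?d} A"
      using A(2) by (metis ex_bij_betw_nat_finite finite)
    \<comment> \<open>Starting from the vertex cover \<open>- A\<close>, the vertices of
      \<open>A\<close> are added one at a time, which makes \<open>?d\<close> strict steps.\<close>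
    define B where "B i = - A \<union> g ` {0..<i}" for i
    define P where "P i = (variable_ideal (B i) :: ('v, 'k) mpoly set)" for i
    have I: "?I \<subseteq> P i" for i
      unfolding P_def using A(1) E
      by (intro edge_ideal_subset_variable_ideal) (auto simp: B_def elim: smaller_indep)
    have strict: "P i \<subset> P (Suc i)" if "i < ?d" for i
    proof -
      have "g i \<in> A" using g that by (auto simp: bij_betw_def)
      moreover have "g i \<notin> g ` {0..<i}"
        using inj_on_image_mem_iff[OF bij_betw_imp_inj_on[OF g], of i "{0..<i}"] that by auto
      ultimately have "Var (g i) \<notin> P i" "Var (g i) \<in> P (Suc i)"
        by (auto simp: P_def B_def Var_in_variable_ideal_iff)
      moreover have "P i \<subseteq> P (Suc i)"
        unfolding P_def by (intro variable_ideal_mono) (auto simp: B_def)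
      ultimately show ?thesis by blast
    qed
    have "primeideal (P i) poly_ring" for i
      unfolding P_def by (rule primeideal_variable_ideal)
    then show "enat ?d \<in> ?S"
      by (intro CollectI exI[of _ ?d] exI[of _ P] conjI refl allI impI I strict) auto
  qed
  then show ?thesis
    by (subst krull_dim_Quot[OF cring_from_type_algebra ideal_edge_ideal])
qed

lemma single_one_eq_iff:
  "Poly_Mapping.single u (1::nat) = Poly_Mapping.single v 1 \<longleftrightarrow> u = v"
proof
  assume "Poly_Mapping.single u (1::nat) = Poly_Mapping.single v 1"
  then have "Poly_Mapping.keys (Poly_Mapping.single u (1::nat)) = Poly_Mapping.keys (Poly_Mapping.single v (1::nat))"
    by simp
  then show "u = v" by simp
qed simp

text \<open>Distinct variables are distinct monomials, so coefficients never add up, whatever the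
  characteristic.\<close>

lemma lookup_sum_Var:
  fixes A :: "'v::finite set"
  shows "Poly_Mapping.lookup (\<Sum>v\<in>A. Var v :: ('v, 'k::field) mpoly) m =
    of_bool (\<exists>v\<in>A. m = Poly_Mapping.single v 1)"
proof (cases "\<exists>v\<in>A. m = Poly_Mapping.single v 1")
  case True
  then obtain u where u: "u \<in> A" "m = Poly_Mapping.single u 1" by blast
  have "Poly_Mapping.lookup (\<Sum>v\<in>A. Var v :: ('v, 'k) mpoly) m = (\<Sum>v\<in>A. if v = u then 1 else 0)"
    unfolding lookup_sum u(2) Var_def
    by (intro sum.cong refl) (simp only: lookup_single when_def single_one_eq_iff)
  also have "\<dots> = 1" using u(1) by simp
  finally show ?thesis using True by simp
next
  case False
  then have "Poly_Mapping.lookup (\<Sum>v\<in>A. Var v :: ('v, 'k) mpoly) m = 0"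
    unfolding lookup_sum Var_def by (intro sum.neutral) (auto simp: lookup_single when_def)
  then show ?thesis using False by simp
qed

lemma Var_square_in_ideal:
  fixes A :: "'v::finite set" and J :: "('v, 'k::field) mpoly set"
  assumes J: "ideal J poly_ring" and "edge_ideal E \<subseteq> J" "(\<Sum>v\<in>A. Var v) \<in> J"
    and "clique A E" "u \<in> A"
  shows "Var u ^ 2 \<in> J"
proof -
  note closed = J[unfolded ideal_of_type_algebra_iff]
  have "Var u * Var v \<in> J" if "v \<in> A - {u}" for v
    using edge_product_in_edge_ideal[of u v E] assms that by (auto simp: clique_def)
  then have "(\<Sum>v\<in>A - {u}. Var u * Var v) \<in> J" by (rule ideal_of_type_algebra_sum[OF J])
  \<comment> \<open>The closure conditions mention no subtraction, so the difference is formed with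
    the multiple by \<open>- 1\<close>.\<close>
  then have "- 1 * (\<Sum>v\<in>A - {u}. Var u * Var v) \<in> J" using closed by blast
  moreover have "Var u * (\<Sum>v\<in>A. Var v) \<in> J" using closed assms(3) by blast
  ultimately have "Var u * (\<Sum>v\<in>A. Var v) + - 1 * (\<Sum>v\<in>A - {u}. Var u * Var v) \<in> J"
    using closed by blast
  also have "Var u * (\<Sum>v\<in>A. Var v) + - 1 * (\<Sum>v\<in>A - {u}. Var u * Var v) =
      (Var u ^ 2 :: ('v, 'k) mpoly)"
  proof -
    have "Var u * (\<Sum>v\<in>A. Var v) = Var u ^ 2 + (\<Sum>v\<in>A - {u}. Var u * Var v :: ('v, 'k) mpoly)"
      using \<open>u \<in> A\<close>
      by (simp add: sum.remove[of A u] distrib_left sum_distrib_left power2_eq_square)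
    then show ?thesis by simp
  qed
  finally show ?thesis .
qed

text \<open>The squares of all variables lie in the ideal, which gives one inclusion of the radical.
  For the other, all generators lie in the irrelevant ideal, which is prime and hence
  radical.\<close>

lemma zero_one_linear_sop_clique_partition:
  fixes E :: "'v::finite set set"
  assumes E: "simple_graph UNIV E"
    and "length As = independence_number UNIV E"
    and part: "partition_list UNIV As"
    and cliques: "\<forall>A\<in>set As. clique A E"
  shows "zero_one_linear_sop (edge_ideal E :: ('v, 'k::field) mpoly set)
    (map (\<lambda>A. \<Sum>v\<in>A. Var v) As)"
  unfolding zero_one_linear_sop_def linear_sop_def
proof (intro conjI)
  let ?fs = "map (\<lambda>A. \<Sum>v\<in>A. Var v) As :: ('v, 'k) mpoly list"
  let ?J = "genideal poly_ring (edge_ideal E \<union> set ?fs)"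
  show "\<forall>f\<in>set ?fs. linear_form f"
    by (auto simp: linear_form_def in_keys_iff lookup_sum_Var split: if_splits)
  show "\<forall>f\<in>set ?fs. \<forall>m. Poly_Mapping.lookup f m \<in> {0, 1}"
    by (auto simp: lookup_sum_Var)
  show "enat (length ?fs) = krull_dim (poly_ring Quot (edge_ideal E :: ('v, 'k) mpoly set))"
    using assms by (simp add: krull_dim_edge_ideal)
  have J: "ideal ?J poly_ring" and sub: "edge_ideal E \<subseteq> ?J" "set ?fs \<subseteq> ?J"
    using genideal_superset[of "edge_ideal E \<union> set ?fs"] by (auto intro: ideal_genideal)
  show "radical_ideal poly_ring ?J = irrelevant_ideal"
  proof
    show "irrelevant_ideal \<subseteq> radical_ideal poly_ring ?J"
      unfolding irrelevant_ideal_def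
    proof (rule genideal_least[OF ideal_radical_ideal[OF J]], safe)
      fix u :: 'v
      obtain A where A: "A \<in> set As" "u \<in> A"
        using part by (auto simp: partition_list_def partition_on_def)
      have "Var u ^ 2 \<in> ?J"
        using Var_square_in_ideal[OF J sub(1), of A u] sub(2) A cliques by auto
      then show "Var u \<in> radical_ideal poly_ring ?J"
        unfolding radical_ideal_of_type_algebra_iff by (intro exI[of _ 2]) simp
    qed
    have "?J \<subseteq> variable_ideal UNIV"
    proof (rule genideal_least[OF ideal_variable_ideal], rule Un_least)
      show "edge_ideal E \<subseteq> (variable_ideal UNIV :: ('v, 'k) mpoly set)"
        using E by (intro edge_ideal_subset_variable_ideal) (auto simp: simple_graph_def)
      show "set ?fs \<subseteq> variable_ideal UNIV"
        by (auto simp: Var_in_variable_ideal_iff intro: ideal_of_type_algebra_sum[OF ideal_variable_ideal])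
    qed
    \<comment> \<open>The case \<open>n = 0\<close> is vacuous, because \<open>1\<close> lies in no
      prime ideal.\<close>
    moreover have "p \<in> variable_ideal UNIV"
      if "p ^ n \<in> variable_ideal UNIV" for p :: "('v, 'k) mpoly" and n
      using that primeideal_variable_ideal[of "UNIV :: 'v set", where 'k = 'k]
      by (induction n) (auto simp: primeideal_of_type_algebra_iff)
    ultimately show "radical_ideal poly_ring ?J \<subseteq> irrelevant_ideal"
      unfolding irrelevant_ideal_eq radical_ideal_of_type_algebra_iff[abs_def] subset_iff
      by (auto simp: radical_ideal_of_type_algebra_iff)
  qed
qed

theorem theorem4p7:
  fixes E :: "'v::finite set set" and d :: nat
  assumes "simple_graph UNIV E"
    and "d = independence_number UNIV E"
  shows
    "(\<forall>As. length As = d \<and> partition_list UNIV As \<and> (\<forall>A\<in>set As. clique A E) \<longrightarrow>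
        zero_one_linear_sop (edge_ideal E :: ('v, 'k::field) mpoly set)
          (map (\<lambda>A. \<Sum>v\<in>A. Var v) As)) \<and>
     (perfect_graph UNIV E \<longrightarrow>
        (\<exists>As. length As = chromatic_number UNIV (complement_edges UNIV E) \<and>
          partition_list UNIV As \<and>
          (\<forall>A\<in>set As. indep A (complement_edges UNIV E)) \<and>
          zero_one_linear_sop (edge_ideal E :: ('v, 'k) mpoly set)
            (map (\<lambda>A. \<Sum>v\<in>A. Var v) As)))"
proof (intro conjI allI impI)
  fix As assume "length As = d \<and> partition_list UNIV As \<and> (\<forall>A\<in>set As. clique A E)"
  then show "zero_one_linear_sop (edge_ideal E :: ('v, 'k) mpoly set) (map (\<lambda>A. \<Sum>v\<in>A. Var v) As)"
    using assms(2) by (intro zero_one_linear_sop_clique_partition[OF assms(1)]) auto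
next
  assume perfect: "perfect_graph UNIV E"
  let ?C = "complement_edges UNIV E"
  obtain Q where Q: "partition_on UNIV Q" "card Q = chromatic_number UNIV ?C" "\<forall>A\<in>Q. indep A ?C"
    by (rule ex_chromatic_number)
  obtain As where As: "set As = Q" "distinct As"
    using finite_distinct_list[OF finite, of Q] by blast
  have len: "length As = chromatic_number UNIV ?C"
    using As Q(2) distinct_card by fastforce
  have "zero_one_linear_sop (edge_ideal E :: ('v, 'k) mpoly set) (map (\<lambda>A. \<Sum>v\<in>A. Var v) As)"
  proof (rule zero_one_linear_sop_clique_partition[OF assms(1)])
    \<comment> \<open>Perfection enters here: the colour classes of the complement are as many as
      the dimension requires.\<close>
    show "length As = independence_number UNIV E"
      using len chromatic_number_complement[OF _ perfect] by simp
    show "partition_list UNIV As" using As Q(1) by (simp add: partition_list_def)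
    show "\<forall>A\<in>set As. clique A E" using As Q(3) by (simp add: indep_complement_edges)
  qed
  then show "\<exists>As. length As = chromatic_number UNIV ?C \<and> partition_list UNIV As \<and>
      (\<forall>A\<in>set As. indep A ?C) \<and>
      zero_one_linear_sop (edge_ideal E :: ('v, 'k) mpoly set) (map (\<lambda>A. \<Sum>v\<in>A. Var v) As)"
    using As Q len by (intro exI[of _ As]) (simp add: partition_list_def)
qed

end
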